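(* Let $n\geq 4$ and let $A$ and $B$ be two $n\times n$ generalized tournament matrices. Suppose that $A$ is indecomposable. If $A$ and $B$ have equal corresponding principal minors of orders at most $4$, then $A=B$ or $A=B^{t}$.
   Context: A generalized tournament matrix of order $n$ is a real $n\times n$ matrix $M=(m_{ij})$ with nonnegative entries satisfying $M+M^{t}=J_n-I_n$ ($J_n$ the all-ones matrix, $I_n$ the identity). Write $[n]=\{1,\ldots,n\}$. A clan of $M$ is a subset $X\subseteq[n]$ such that for all $i,j\in X$ and $k\in[n]\setminus X$, $m_{ik}=m_{jk}$ and $m_{ki}=m_{kj}$. The empty set, singletons and $[n]$ are the trivial clans; $M$ is indecomposable if all its clans are trivial. *)

theory Defs
  imports "Jordan_Normal_Form.Determinant" "Jordan_Normal_Form.DL_Submatrix"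
begin

text \<open>Indices are 0-based: [n] is rendered as {0..<n}.\<close>

definition all_ones_mat :: "nat \<Rightarrow> real mat" where
  "all_ones_mat n = Matrix.mat n n (\<lambda>_. 1)"

definition gen_tournament :: "nat \<Rightarrow> real mat \<Rightarrow> bool" where
  "gen_tournament n M \<longleftrightarrow> M \<in> carrier_mat n n \<and>
     (\<forall>i<n. \<forall>j<n. M $$ (i,j) \<ge> 0) \<and>
     M + transpose_mat M = all_ones_mat n - 1\<^sub>m n"

definition is_clan :: "nat \<Rightarrow> real mat \<Rightarrow> nat set \<Rightarrow> bool" where
  "is_clan n M X \<longleftrightarrow> X \<subseteq> {0..<n} \<and>
     (\<forall>i\<in>X. \<forall>j\<in>X. \<forall>k\<in>{0..<n} - X. M $$ (i,k) = M $$ (j,k) \<and> M $$ (k,i) = M $$ (k,j))"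

definition indecomposable :: "nat \<Rightarrow> real mat \<Rightarrow> bool" where
  "indecomposable n M \<longleftrightarrow>
     (\<forall>X. is_clan n M X \<longrightarrow> X = {} \<or> card X = 1 \<or> X = {0..<n})"

definition principal_minor :: "real mat \<Rightarrow> nat set \<Rightarrow> real" where
  "principal_minor M X = det (submatrix M X X)"

end

theory Submission
  imports Defs
begin

text \<open>
  Let \<open>a\<^sub>i\<^sub>j = m\<^sub>i\<^sub>j - m\<^sub>j\<^sub>i\<close> and \<open>b\<close> be the skew-symmetric parts of \<open>A\<close> and \<open>B\<close>. Equality of the minors of
  order 2 gives \<open>b\<^sub>i\<^sub>j = \<plusminus>a\<^sub>i\<^sub>j\<close>, so every pair with \<open>a\<^sub>i\<^sub>j \<noteq> 0\<close> is \<^emph>\<open>positive\<close> or \<^emph>\<open>negative\<close>. By the minors of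
  order 3, each component of the negative graph, and of the positive graph, is a clan of \<open>A\<close>. As \<open>A\<close>
  is indecomposable, either one of the two graphs has no edge, which is the conclusion, or both are
  connected. In the latter case there is a cut \<open>V = P \<union> Q\<close> on which \<open>a\<close> is a nonzero constant, and then
  \<open>P\<close> or \<open>Q\<close> is a nontrivial clan.

  The cut is found by induction on \<open>V\<close>. If deleting some vertex disconnects one of the two graphs, the
  components left over determine all values between them and the vertex up to a sign, the minors of
  order 4 relating the two absolute values that occur. Otherwise every \<open>V - {v}\<close> has a constant cut by
  induction, and a skew function on at least 5 points all of whose one-point deletions have a constant
  cut has one itself.
\<close>

section \<open>Constant cuts of skew functions\<close>

definition skew :: "('v \<Rightarrow> 'v \<Rightarrow> real) \<Rightarrow> bool" where
  "skew a \<longleftrightarrow> (\<forall>i j. a j i = - a i j)"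

lemma skewD: "skew a \<Longrightarrow> a j i = - a i j"
  unfolding skew_def by blast

lemma skew_diag: "skew a \<Longrightarrow> a i i = 0"
  using skewD[of a i i] by linarith

definition const_cut :: "('v \<Rightarrow> 'v \<Rightarrow> real) \<Rightarrow> 'v set \<Rightarrow> 'v set \<Rightarrow> real \<Rightarrow> bool" where
  "const_cut a V P x \<longleftrightarrow> P \<subseteq> V \<and> P \<noteq> {} \<and> P \<noteq> V \<and> x \<noteq> 0 \<and> (\<forall>p\<in>P. \<forall>q\<in>V - P. a p q = x)"

lemma const_cutI:
  assumes "p \<in> P" "q \<in> V - P" "P \<subseteq> V" "x \<noteq> 0"
    and "\<And>p q. p \<in> P \<Longrightarrow> q \<in> V - P \<Longrightarrow> a p q = x"
  shows "const_cut a V P x"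
  using assms unfolding const_cut_def by blast

lemma const_cutD: "const_cut a V P x \<Longrightarrow> p \<in> P \<Longrightarrow> q \<in> V \<Longrightarrow> q \<notin> P \<Longrightarrow> a p q = x"
  unfolding const_cut_def by blast

lemma const_cut_compl:
  assumes "skew a" "const_cut a V P x"
  shows "const_cut a V (V - P) (- x)"
proof -
  obtain p q where "p \<in> P" "q \<in> V - P" "P \<subseteq> V" "x \<noteq> 0"
    using assms(2) unfolding const_cut_def by blast
  moreover have "a i j = - x" if "i \<in> V - P" "j \<in> V - (V - P)" for i j
    using const_cutD[OF assms(2), of j i] skewD[OF assms(1), of i j] that by auto
  ultimately show ?thesis
    by (intro const_cutI[of q _ p]) auto
qed

lemma const_cut_restrict:
  assumes "const_cut a V P x" "W \<subseteq> V" "p \<in> W \<inter> P" "q \<in> W - P"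
  shows "const_cut a W (W \<inter> P) x"
  using assms by (intro const_cutI[of p _ q]) (auto simp: const_cut_def)

text \<open>Either some pair crosses both cuts in the same direction, which gives
  \<open>x' = x\<close>, or some pair crosses them in opposite directions, which gives
  \<open>x' = - x\<close>.\<close>

lemma const_cut_weight_unique:
  assumes "skew a" "const_cut a V P x" "const_cut a V P' x'"
  shows "x' = x \<or> x' = - x"
proof (cases "(\<exists>p\<in>P \<inter> P'. \<exists>q\<in>V. q \<notin> P \<and> q \<notin> P')")
  case True
  then obtain p q where "p \<in> P" "p \<in> P'" "q \<in> V" "q \<notin> P" "q \<notin> P'" by blast
  then show ?thesis using const_cutD[OF assms(2), of p q] const_cutD[OF assms(3), of p q] by simp
next
  case False
  obtain p q p' q' where *: "p \<in> P" "q \<in> V - P" "p' \<in> P'" "q' \<in> V - P'" "P \<subseteq> V" "P' \<subseteq> V"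
    using assms(2,3) unfolding const_cut_def by blast
  obtain i j where ij: "i \<in> P" "i \<notin> P'" "j \<in> P'" "j \<notin> P"
  proof (cases "P \<inter> P' = {}")
    case True
    then show ?thesis using that[of p p'] * by blast
  next
    case inter: False
    then have "V \<subseteq> P \<union> P'" using False by blast
    then show ?thesis using that[of q' q] * by blast
  qed
  then have "a i j = x" "a j i = x'"
    using * const_cutD[OF assms(2), of i j] const_cutD[OF assms(3), of j i] by auto
  then show ?thesis using skewD[OF assms(1), of i j] by simp
qed

text \<open>Points of \<open>P - P'\<close> and \<open>P' - P\<close> would be joined by the value
  \<open>x\<close> in both directions, against skewness and \<open>x \<noteq> 0\<close>.\<close>

lemma const_cut_nested:
  assumes "skew a" "const_cut a V P x" "const_cut a V P' x"
  shows "P \<subseteq> P' \<or> P' \<subseteq> P"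
proof (rule ccontr)
  assume "\<not> ?thesis"
  then obtain i j where ij: "i \<in> P" "i \<notin> P'" "j \<in> P'" "j \<notin> P" by blast
  moreover have "P \<subseteq> V" "P' \<subseteq> V" "x \<noteq> 0" using assms unfolding const_cut_def by auto
  ultimately have "a i j = x" "a j i = x"
    using const_cutD[OF assms(2), of i j] const_cutD[OF assms(3), of j i] by auto
  then show False using skewD[OF assms(1), of i j] \<open>x \<noteq> 0\<close> by simp
qed

text \<open>Taking the smallest side \<open>P\<close> of all cuts makes the cuts of \<open>V - {v}\<close> and \<open>V - {p}\<close>, \<open>p \<in> P\<close>,
  restrict to nested cuts of \<open>V - {v, p}\<close> with the same value.\<close>

lemma const_cut_critical_large:
  fixes a :: "'v \<Rightarrow> 'v \<Rightarrow> real"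
  assumes sk: "skew a" and fin: "finite V"
    and ex: "\<And>v. v \<in> V \<Longrightarrow> \<exists>P x. const_cut a (V - {v}) P x"
    and v: "v \<in> V" and P: "const_cut a (V - {v}) P x" and two: "card P \<ge> 2"
    and min: "\<And>w P' y. w \<in> V \<Longrightarrow> const_cut a (V - {w}) P' y \<Longrightarrow> card P \<le> card P'"
  shows "\<exists>P x. const_cut a V P x"
proof -
  have PV: "P \<subseteq> V - {v}" and x0: "x \<noteq> 0" using P unfolding const_cut_def by auto
  have finP: "finite P" using PV fin finite_subset by blast
  obtain q where q: "q \<in> V" "q \<noteq> v" "q \<notin> P" using P unfolding const_cut_def by blast
  \<comment> \<open>The exception \<open>p\<close> is harmless: as \<open>P\<close> has two points,
    the claim for both of them covers all of \<open>P\<close>, and then \<open>P\<close> itself is a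
    cut of \<open>V\<close>.\<close>
  have claim: "(\<forall>p'\<in>P - {p}. a p' v = x) \<or> (\<exists>P x. const_cut a V P x)" if p: "p \<in> P" for p
  proof -
    have pV: "p \<in> V" "p \<noteq> v" using p PV by auto
    have ne: "R - {r} \<noteq> {}" if "card P \<le> card R" for r and R :: "'v set"
    proof
      assume "R - {r} = {}"
      then have "card R \<le> card {r}" by (intro card_mono) auto
      then show False using that two by simp
    qed
    obtain P0 x' where P0: "const_cut a (V - {p}) P0 x'" using ex pV by blast
    let ?Y = "V - {v} - {p}"
    \<comment> \<open>Complements of cuts are cuts, so by minimality both sides of a cut of
      \<open>V - {p}\<close> have at least \<open>card P \<ge> 2\<close> points and stay nonempty
      when \<open>v\<close> is deleted.\<close>
    have sub: "const_cut a ?Y (?Y \<inter> R) y" if R: "const_cut a (V - {p}) R y" for R y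
    proof -
      have R': "const_cut a (V - {p}) (V - {p} - R) (- y)" by (rule const_cut_compl[OF sk R])
      obtain r where "r \<in> R - {v}" using ne[OF min[OF pV(1) R]] by blast
      moreover obtain s where "s \<in> V - {p} - R - {v}" using ne[OF min[OF pV(1) R']] by blast
      moreover have "R \<subseteq> V - {p}" using R unfolding const_cut_def by blast
      ultimately show ?thesis by (intro const_cut_restrict[OF R, of _ r s]) auto
    qed
    obtain p' where "p' \<in> P - {p}" using ne[of P p] by blast
    then have PY: "const_cut a ?Y (?Y \<inter> P) x"
      using q p PV by (intro const_cut_restrict[OF P, of _ p' q]) auto
    have "x' = x \<or> x' = - x" using const_cut_weight_unique[OF sk PY sub[OF P0]] .
    then obtain P' where P': "const_cut a (V - {p}) P' x"
      using P0 const_cut_compl[OF sk P0] by auto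
    have P'V: "P' \<subseteq> V - {p}" and P'ne: "P' \<noteq> V - {p}" using P' unfolding const_cut_def by auto
    have YP: "?Y \<inter> P = P - {p}" and YP': "?Y \<inter> P' = P' - {v}" using PV P'V by auto
    have nest: "P - {p} \<subseteq> P' - {v} \<or> P' - {v} \<subseteq> P - {p}"
      using const_cut_nested[OF sk PY sub[OF P']] unfolding YP YP' .
    have cardle: "card P \<le> card P'" using min[OF pV(1) P'] .
    \<comment> \<open>Minimality of \<open>card P\<close> decides the direction of the
      nesting.\<close>
    have "card (P - {p}) \<le> card (P' - {v})"
      using diff_le_mono[OF cardle, of 1] p cardle
      by (cases "v \<in> P'") (simp_all add: card_Diff_singleton_if)
    then have sub2: "P - {p} \<subseteq> P' - {v}"
      using nest card_seteq[of "P - {p}" "P' - {v}"] finP by blast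
    show ?thesis
    proof (cases "v \<in> P'")
      case False
      then show ?thesis using sub2 const_cutD[OF P', of _ v] v pV by auto
    next
      case True
      obtain r where r: "r \<in> V - {p} - P'" using P'V P'ne by blast
      \<comment> \<open>Here \<open>p\<close> can join \<open>P'\<close>: a point outside
        \<open>insert p P'\<close> is neither \<open>v\<close> nor in \<open>P\<close>, so it
        receives \<open>x\<close> from \<open>p\<close>.\<close>
      have "const_cut a V (insert p P') x"
      proof (rule const_cutI[of p _ r])
        fix i j assume ij: "i \<in> insert p P'" "j \<in> V - insert p P'"
        then have "j \<notin> P" "j \<noteq> v" using sub2 True by auto
        then show "a i j = x"
          using ij const_cutD[OF P, of p j] const_cutD[OF P', of i j] p by auto
      qed (use r P'V pV \<open>x \<noteq> 0\<close> in auto)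
      then show ?thesis by blast
    qed
  qed
  obtain p1 p2 where p12: "p1 \<in> P" "p2 \<in> P" "p1 \<noteq> p2"
    using two card_le_Suc0_iff_eq[OF finP] by fastforce
  show ?thesis
  proof (rule ccontr)
    assume no: "\<not> ?thesis"
    then have *: "a p v = x" if "p \<in> P" for p using claim[of p1] claim[of p2] p12 that by blast
    have "const_cut a V P x"
    proof (rule const_cutI[of p1 _ v])
      fix i j assume "i \<in> P" "j \<in> V - P"
      then show "a i j = x" using * const_cutD[OF P, of i j] by (cases "j = v") auto
    qed (use p12 PV v x0 in auto)
    then show False using no by blast
  qed
qed

text \<open>Reachability from \<open>u\<close> in the digraph with arcs \<open>a i j \<noteq> x\<close> is phrased as the absence of
  \<open>x\<close>-cuts with \<open>u\<close> on the left.\<close>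

lemma const_cut_avoiding_insert:
  assumes "\<And>P. u \<in> P \<Longrightarrow> \<not> const_cut a T P x" "u \<in> T" "t \<in> T" "y \<notin> T" "a t y \<noteq> x" "u \<in> P"
  shows "\<not> const_cut a (insert y T) P x"
proof
  assume J: "const_cut a (insert y T) P x"
  show False
  proof (cases "\<exists>q\<in>T. q \<notin> P")
    case True
    then obtain q where "q \<in> T" "q \<notin> P" by blast
    then have "const_cut a T (T \<inter> P) x"
      using assms(2,6) by (intro const_cut_restrict[OF J, of _ u q]) auto
    then show False using assms(1)[of "T \<inter> P"] assms(2,6) by blast
  next
    case False
    then have "y \<notin> P" using J unfolding const_cut_def by blast
    then show False using const_cutD[OF J, of t y] False assms by auto
  qed
qed

text \<open>As \<open>V\<close> has no \<open>x\<close>-cut, an arc with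
  \<open>a t y \<noteq> x\<close> leaves every proper subset \<open>T\<close> containing
  \<open>u\<close>, and adding its head keeps all points reachable from \<open>u\<close>. Growing
  \<open>T\<close> until a single point is missing yields \<open>w\<close>.\<close>

lemma const_cut_avoiding_deletion:
  assumes "finite V" "\<And>P x. \<not> const_cut a V P x" "x \<noteq> 0"
    and "T \<subset> V" "u \<in> T" "\<And>P. u \<in> P \<Longrightarrow> \<not> const_cut a T P x"
  shows "\<exists>w\<in>V - T. \<forall>P. u \<in> P \<longrightarrow> \<not> const_cut a (V - {w}) P x"
  using assms(4-)
proof (induction "card (V - T)" arbitrary: T rule: less_induct)
  case less
  have "\<not> (\<forall>t\<in>T. \<forall>y\<in>V - T. a t y = x)"
    using assms(2)[of T x] less.prems assms(3) unfolding const_cut_def by blast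
  then obtain t y where ty: "t \<in> T" "y \<in> V - T" "a t y \<noteq> x" by blast
  show ?case
  proof (cases "insert y T = V")
    case True
    then have "V - {y} = T" using ty by blast
    then show ?thesis using less.prems ty by auto
  next
    case False
    have "\<exists>w\<in>V - insert y T. \<forall>P. u \<in> P \<longrightarrow> \<not> const_cut a (V - {w}) P x"
    proof (rule less.hyps)
      show "card (V - insert y T) < card (V - T)"
        using ty assms(1) by (intro psubset_card_mono) auto
      show "\<not> const_cut a (insert y T) P x" if "u \<in> P" for P
        using ty less.prems that by (intro const_cut_avoiding_insert[of u a T x t y]) auto
    qed (use less.prems ty False in auto)
    then show ?thesis by blast
  qed
qed

text \<open>Suppose \<open>V\<close> has no cut. As \<open>u\<close> sends \<open>x\<close> to every
  point but \<open>v\<close>, a cut of a deletion \<open>V - {w}\<close> with \<open>u\<close> on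
  the left and a value other than \<open>x\<close> has right side \<open>{v}\<close>. Two different
  such \<open>w\<close> force all points to send the same value to \<open>v\<close>, so
  \<open>V - {v}\<close> is a side of a cut of \<open>V\<close> after all.\<close>

lemma const_cut_critical_singleton:
  fixes a :: "'v \<Rightarrow> 'v \<Rightarrow> real"
  assumes sk: "skew a" and fin: "finite V" and five: "card V \<ge> 5"
    and ex: "\<And>v. v \<in> V \<Longrightarrow> \<exists>P x. const_cut a (V - {v}) P x"
    and v: "v \<in> V" and P: "const_cut a (V - {v}) {u} x"
  shows "\<exists>P x. const_cut a V P x"
proof (rule ccontr)
  assume no: "\<not> ?thesis"
  have u: "u \<in> V" "u \<noteq> v" and x0: "x \<noteq> 0" using P unfolding const_cut_def by auto
  have ux: "a u y = x" if "y \<in> V" "y \<noteq> u" "y \<noteq> v" for y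
    using const_cutD[OF P] that by auto
  have uv: "a u v \<noteq> x"
  proof
    assume "a u v = x"
    then have "const_cut a V {u} x" using ux u v x0 by (intro const_cutI[of u _ v]) auto
    then show False using no by blast
  qed
  define free where "free T \<longleftrightarrow> (\<forall>P. u \<in> P \<longrightarrow> \<not> const_cut a T P x)" for T
  have freeI: "free (insert y T)" if "free T" "u \<in> T" "t \<in> T" "y \<notin> T" "a t y \<noteq> x" for T t y
    unfolding free_def
    using that const_cut_avoiding_insert[of u a T x t y] unfolding free_def by blast
  \<comment> \<open>The point \<open>w\<close> is chosen so that all of \<open>V - {w}\<close> is
    reachable from \<open>u\<close>. Its cut with \<open>u\<close> on the left cannot have the value
    \<open>x\<close>, whereas any right point other than \<open>v\<close> receives \<open>x\<close>
    from \<open>u\<close>.\<close>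
  have sink: "\<exists>w\<in>V - T. a u v \<noteq> 0 \<and> (\<forall>y\<in>V - {w} - {v}. a y v = a u v)"
    if T: "free T" "T \<subset> V" "u \<in> T" "v \<in> T" for T
  proof -
    obtain w where w: "w \<in> V - T" "free (V - {w})"
      using const_cut_avoiding_deletion[OF fin, of a x T u] no x0 T unfolding free_def by blast
    obtain P0 z0 where P0: "const_cut a (V - {w}) P0 z0" using ex w by blast
    have "w \<noteq> u" "w \<noteq> v" using w T by auto
    obtain P' z where P': "const_cut a (V - {w}) P' z" "u \<in> P'"
    proof (cases "u \<in> P0")
      case False
      then have "u \<in> V - {w} - P0" using u \<open>w \<noteq> u\<close> by blast
      then show ?thesis using that const_cut_compl[OF sk P0] by blast
    qed (use P0 that in blast)
    have "z \<noteq> x" using w(2) P' unfolding free_def by blast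
    have P'V: "P' \<subseteq> V - {w}" and "P' \<noteq> V - {w}" and "z \<noteq> 0" using P' unfolding const_cut_def by auto
    then obtain r where r: "r \<in> V - {w} - P'" by blast
    have only: "s = v" if "s \<in> V - {w} - P'" for s
    proof (rule ccontr)
      assume "s \<noteq> v"
      then have "a u s = x" "a u s = z" using that ux[of s] const_cutD[OF P'(1), of u s] P'(2) by auto
      then show False using \<open>z \<noteq> x\<close> by simp
    qed
    then have "r = v" using r by blast
    then have "a y v = z" if "y \<in> V - {w} - {v}" for y
      using only[of y] const_cutD[OF P'(1), of y v] r that by auto
    then show ?thesis using w(1) u v \<open>z \<noteq> 0\<close> \<open>w \<noteq> u\<close> by (intro bexI[of _ w]) auto
  qed
  have proper: "T \<subset> V" if "T \<subseteq> V" "card T \<le> 4" for T using that five by auto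
  have free2: "free {u, v}"
    unfolding free_def
  proof (intro allI impI notI)
    fix P assume "u \<in> P" and J: "const_cut a {u, v} P x"
    then have "v \<notin> P" unfolding const_cut_def by blast
    then show False using const_cutD[OF J, of u v] \<open>u \<in> P\<close> uv by auto
  qed
  have "{u, v} \<subset> V" using u v by (intro proper) (auto simp: card_insert_if)
  then obtain w where w: "w \<in> V - {u, v}" and uv0: "a u v \<noteq> 0"
    and wz: "\<And>y. y \<in> V - {w} - {v} \<Longrightarrow> a y v = a u v"
    using sink[OF free2] by blast
  have wv: "a w v \<noteq> a u v"
  proof
    assume *: "a w v = a u v"
    have "const_cut a V (V - {v}) (a u v)"
    proof (rule const_cutI[of u _ v])
      fix i j assume "i \<in> V - {v}" "j \<in> V - (V - {v})"
      then have "j = v" "i = w \<or> i \<in> V - {w} - {v}" by auto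
      then show "a i j = a u v" using * wz by blast
    qed (use u v uv0 in auto)
    then show False using no by blast
  qed
  \<comment> \<open>A second deletion must avoid \<open>w\<close>, so \<open>w\<close> has to be
    reached from \<open>u\<close> within at most four points; five points in \<open>V\<close> then
    leave one to omit.\<close>
  obtain T where T: "free T" "T \<subset> V" "u \<in> T" "v \<in> T" "w \<in> T"
  proof (cases "a v w = x")
    case False
    have "free (insert w {u, v})" using freeI[of "{u, v}" v w] free2 w False by auto
    moreover have "insert w {u, v} \<subset> V" using u v w by (intro proper) (auto simp: card_insert_if)
    ultimately show ?thesis using that[of "insert w {u, v}"] by auto
  next
    case True
    have "\<exists>t\<in>V - {w}. a t w \<noteq> x"
    proof (rule ccontr)
      assume "\<not> ?thesis"
      then have "const_cut a V (V - {w}) x" using u w x0 by (intro const_cutI[of u _ w]) auto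
      then show False using no by blast
    qed
    then obtain t where t: "t \<in> V" "t \<noteq> w" "a t w \<noteq> x" by blast
    have tuv: "t \<noteq> u" "t \<noteq> v" using t True ux[of w] w by auto
    \<comment> \<open>By the choice of \<open>w\<close>, \<open>a t v = a u v\<close>, which differs
      from \<open>a w v = - x\<close>. So \<open>t\<close> is reached from \<open>v\<close>, and
      \<open>w\<close> from \<open>t\<close>.\<close>
    have "a v t \<noteq> x"
      using wz[of t] t tuv True wv skewD[OF sk, of v t] skewD[OF sk, of v w] by force
    then have "free (insert t {u, v})" using freeI[of "{u, v}" v t] free2 tuv by auto
    then have "free (insert w (insert t {u, v}))" using freeI[of "insert t {u, v}" t w] t w by auto
    moreover have "insert w (insert t {u, v}) \<subset> V"
      using u v w t by (intro proper) (auto simp: card_insert_if)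
    ultimately show ?thesis using that[of "insert w (insert t {u, v})"] by auto
  qed
  then obtain w' where "w' \<in> V - T" "\<forall>y\<in>V - {w'} - {v}. a y v = a u v"
    using sink[OF T(1-4)] by blast
  moreover from this have "w \<in> V - {w'} - {v}" using w T by blast
  ultimately show False using wv by blast
qed

lemma const_cut_critical:
  fixes a :: "'v \<Rightarrow> 'v \<Rightarrow> real"
  assumes sk: "skew a" and fin: "finite V" and five: "card V \<ge> 5"
    and ex: "\<And>v. v \<in> V \<Longrightarrow> \<exists>P x. const_cut a (V - {v}) P x"
  shows "\<exists>P x. const_cut a V P x"
proof -
  define Q where "Q k \<longleftrightarrow> (\<exists>v P x. v \<in> V \<and> const_cut a (V - {v}) P x \<and> card P = k)" for k
  have "V \<noteq> {}" using five by auto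
  then have "\<exists>k. Q k" using ex unfolding Q_def by blast
  then have "Q (LEAST k. Q k)" by (rule LeastI_ex)
  then obtain v P x where v: "v \<in> V" "const_cut a (V - {v}) P x" and eq: "card P = (LEAST k. Q k)"
    unfolding Q_def by blast
  have min: "card P \<le> card P'" if "w \<in> V" "const_cut a (V - {w}) P' y" for w P' y
    unfolding eq using that by (intro Least_le) (auto simp: Q_def)
  show ?thesis
  proof (cases "card P \<ge> 2")
    case True
    then show ?thesis using const_cut_critical_large[OF sk fin ex v] min by blast
  next
    case False
    have "P \<noteq> {}" "finite P" using v fin unfolding const_cut_def by (auto intro: finite_subset)
    then have "card P = 1" using False by (metis card_0_eq less_2_cases not_le One_nat_def)
    then obtain u where "P = {u}" using card_1_singletonE by blast
    then show ?thesis using const_cut_critical_singleton[OF sk fin five ex v(1)] v(2) by blast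
  qed
qed

section \<open>Functions with the same minors\<close>

text \<open>The edges of the positive graph; \<open>oppose\<close> gives the negative one. Requiring
  \<open>a i j \<noteq> 0\<close> makes the two graphs disjoint.\<close>

definition agree :: "('v \<Rightarrow> 'v \<Rightarrow> real) \<Rightarrow> ('v \<Rightarrow> 'v \<Rightarrow> real) \<Rightarrow> 'v \<Rightarrow> 'v \<Rightarrow> bool" where
  "agree a b i j \<longleftrightarrow> a i j \<noteq> 0 \<and> b i j = a i j"

definition oppose :: "('v \<Rightarrow> 'v \<Rightarrow> real) \<Rightarrow> ('v \<Rightarrow> 'v \<Rightarrow> real) \<Rightarrow> 'v \<Rightarrow> 'v \<Rightarrow> bool" where
  "oppose a b i j \<longleftrightarrow> a i j \<noteq> 0 \<and> b i j = - a i j"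

section \<open>Connectivity and reachability inside a vertex set\<close>

definition conn :: "('v \<Rightarrow> 'v \<Rightarrow> bool) \<Rightarrow> 'v set \<Rightarrow> bool" where
  "conn E V \<longleftrightarrow> (\<forall>S. S \<subseteq> V \<longrightarrow> S \<noteq> {} \<longrightarrow> S \<noteq> V \<longrightarrow> (\<exists>i\<in>S. \<exists>j\<in>V - S. E i j))"

text \<open>Paths stay inside \<open>W\<close>, except that every point reaches itself even outside
  \<open>W\<close>; hence the separate membership conditions below.\<close>

definition reach :: "('v \<Rightarrow> 'v \<Rightarrow> bool) \<Rightarrow> 'v set \<Rightarrow> 'v \<Rightarrow> 'v \<Rightarrow> bool" where
  "reach E W = (\<lambda>i j. i \<in> W \<and> j \<in> W \<and> E i j)\<^sup>*\<^sup>*"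

lemma connE:
  assumes "conn E V" "s \<in> S" "t \<in> V - S" "S \<subseteq> V"
  obtains i j where "i \<in> S" "j \<in> V - S" "E i j"
  using assms unfolding conn_def by blast

lemma reach_refl: "reach E W i i"
  unfolding reach_def by simp

lemma reach_edge: "i \<in> W \<Longrightarrow> j \<in> W \<Longrightarrow> E i j \<Longrightarrow> reach E W i j"
  unfolding reach_def by (rule r_into_rtranclp) simp

lemma reach_trans: "reach E W i j \<Longrightarrow> reach E W j k \<Longrightarrow> reach E W i k"
  unfolding reach_def by (rule rtranclp_trans)

lemma reach_step: "reach E W i j \<Longrightarrow> j \<in> W \<Longrightarrow> k \<in> W \<Longrightarrow> E j k \<Longrightarrow> reach E W i k"
  by (rule reach_trans[OF _ reach_edge])

lemma reach_sym:
  assumes "\<And>i j. E i j \<Longrightarrow> E j i" "reach E W i j"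
  shows "reach E W j i"
proof -
  have "symp (\<lambda>i j. i \<in> W \<and> j \<in> W \<and> E i j)" using assms(1) by (auto intro: sympI)
  from sympD[OF symp_rtranclp[OF this]] show ?thesis using assms(2) unfolding reach_def by blast
qed

lemma reach_boundary:
  assumes "reach E W i j" "Q i" "\<not> Q j" "i \<in> W"
  obtains k l where "reach E W i k" "reach E W i l" "E k l" "Q k" "\<not> Q l" "k \<in> W" "l \<in> W"
proof -
  have "\<not> Q j \<longrightarrow> (\<exists>k l. reach E W i k \<and> reach E W i l \<and> E k l \<and> Q k \<and> \<not> Q l \<and> k \<in> W \<and> l \<in> W)"
    using assms(1)[unfolded reach_def]
  proof (induction rule: rtranclp_induct)
    case base
    then show ?case using assms(2) by simp
  next
    case (step y z)
    have "reach E W i y" using step(1) unfolding reach_def .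
    moreover from this have "reach E W i z" using step(2) reach_step[of E W i y z] by blast
    ultimately show ?case using step by blast
  qed
  then show ?thesis using assms(3) that by blast
qed

text \<open>Here \<open>i\<close> is arbitrary: if it reached points on both sides of a split
  without crossing edges, symmetry would give a path between the sides through
  \<open>i\<close>.\<close>

lemma not_conn_imp_not_reach:
  assumes "\<not> conn E W" "\<And>i j. E i j \<Longrightarrow> E j i"
  obtains u where "u \<in> W" "\<not> reach E W i u"
proof -
  obtain S where S: "S \<subseteq> W" "S \<noteq> {}" "S \<noteq> W" "\<And>i j. i \<in> S \<Longrightarrow> j \<in> W - S \<Longrightarrow> \<not> E i j"
    using assms(1) unfolding conn_def by blast
  obtain s s' where ss: "s \<in> S" "s' \<in> W - S" using S by blast
  have "\<not> reach E W s s'"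
  proof
    assume "reach E W s s'"
    then obtain k l where "E k l" "k \<in> S" "l \<notin> S" "l \<in> W"
      using reach_boundary[of E W s s' "\<lambda>i. i \<in> S"] ss S(1) by blast
    then show False using S(4) by blast
  qed
  then show ?thesis
    using that[of s] that[of s'] ss S(1) reach_sym[of E W i s, OF assms(2)] reach_trans[of E W s i s']
    by blast
qed

text \<open>Up to a term in the squares, \<open>quadruple\<close> is the squared Pfaffian of a principal \<open>4 \<times> 4\<close> submatrix
  of \<open>a\<close>, and \<open>triple\<close> is the same for \<open>a\<close> bordered by a row of ones.\<close>

locale same_minors =
  fixes V :: "'v set" and a b :: "'v \<Rightarrow> 'v \<Rightarrow> real"
  assumes skew_a: "skew a" and skew_b: "skew b"
    and sign_cases: "\<And>i j. i \<in> V \<Longrightarrow> j \<in> V \<Longrightarrow> b i j = a i j \<or> b i j = - a i j"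
    and triple: "\<And>i j k. i \<in> V \<Longrightarrow> j \<in> V \<Longrightarrow> k \<in> V \<Longrightarrow>
      a i j * a j k + a j k * a k i + a k i * a i j = b i j * b j k + b j k * b k i + b k i * b i j"
    and quadruple: "\<And>i j k l. i \<in> V \<Longrightarrow> j \<in> V \<Longrightarrow> k \<in> V \<Longrightarrow> l \<in> V \<Longrightarrow> distinct [i, j, k, l] \<Longrightarrow>
      (a i j * a k l) * (a i k * a l j) + (a i k * a l j) * (a i l * a j k) + (a i l * a j k) * (a i j * a k l) =
      (b i j * b k l) * (b i k * b l j) + (b i k * b l j) * (b i l * b j k) + (b i l * b j k) * (b i j * b k l)"

lemma same_minors_subset:
  assumes "same_minors V a b" "W \<subseteq> V"
  shows "same_minors W a b"
proof -
  interpret same_minors V a b by fact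
  show ?thesis
  proof
    show "skew a" "skew b" by (rule skew_a skew_b)+
    show "b i j = a i j \<or> b i j = - a i j" if "i \<in> W" "j \<in> W" for i j
      using that assms(2) by (intro sign_cases) auto
  qed ((rule triple quadruple; blast intro: subsetD[OF assms(2)])+)
qed

text \<open>Negating \<open>b\<close> exchanges the positive and the negative graph, so each result
  about one of them transfers to the other.\<close>

lemma same_minors_uminus:
  assumes "same_minors V a b"
  shows "same_minors V a (\<lambda>i j. - b i j)"
proof -
  interpret same_minors V a b by fact
  show ?thesis
  proof
    show "skew (\<lambda>i j. - b i j)"
      unfolding skew_def
    proof (intro allI)
      show "- b j i = - (- b i j)" for i j using skewD[OF skew_b, of i j] by simp
    qed
    show "- b i j = a i j \<or> - b i j = - a i j" if "i \<in> V" "j \<in> V" for i j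
      using sign_cases[OF that] by auto
  qed (use skew_a triple quadruple in simp_all)
qed

lemma agree_uminus: "agree a (\<lambda>i j. - b i j) = oppose a b"
  unfolding agree_def oppose_def by (intro ext conj_cong refl iffI) linarith+

lemma oppose_uminus: "oppose a (\<lambda>i j. - b i j) = agree a b"
  unfolding agree_def oppose_def by (intro ext conj_cong refl iffI) linarith+

section \<open>The positive and negative graphs, their components and cut vertices\<close>

context same_minors
begin

abbreviation pos where "pos \<equiv> agree a b"
abbreviation neg where "neg \<equiv> oppose a b"

lemma pos_sym: "pos i j \<Longrightarrow> pos j i"
  unfolding agree_def using skewD[OF skew_a, of i j] skewD[OF skew_b, of i j] by simp

lemma neg_sym: "neg i j \<Longrightarrow> neg j i"
  unfolding oppose_def using skewD[OF skew_a, of i j] skewD[OF skew_b, of i j] by simp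

lemma pos_not_neg: "pos i j \<Longrightarrow> \<not> neg i j"
  unfolding agree_def oppose_def by auto

lemma pos_neg_cases: "i \<in> V \<Longrightarrow> j \<in> V \<Longrightarrow> a i j = 0 \<or> pos i j \<or> neg i j"
  unfolding agree_def oppose_def using sign_cases by blast

text \<open>For either sign of the pair \<open>i k\<close>, the identity \<open>triple\<close>
  factors into a nonzero value times a difference. So in a triangle with edges of both kinds the
  third side is nonzero too, and the two like edges carry equal values at their common
  vertex.\<close>

lemma pos_neg_triangle:
  assumes "i \<in> V" "j \<in> V" "k \<in> V" "pos i j" "neg j k"
  shows "(neg i k \<and> a k i = a k j) \<or> (pos i k \<and> a i j = a i k)"
proof -
  have bs: "b i j = a i j" "b j k = - a j k" "a i j \<noteq> 0" "a j k \<noteq> 0"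
    using assms(4,5) unfolding agree_def oppose_def by auto
  have aki: "a k i = - a i k" "a k j = - a j k" "b k i = - b i k"
    using skewD[OF skew_a] skewD[OF skew_b] by blast+
  have eq: "a i j * a j k - a j k * a i k - a i k * a i j = - (a i j * a j k) + a j k * b i k - b i k * a i j"
    using triple[OF assms(1-3)] unfolding bs aki by simp
  consider "b i k = a i k" | "b i k = - a i k" using sign_cases assms(1,3) by blast
  then show ?thesis
  proof cases
    case 1
    have "a j k * (a i j - a i k) = 0"
      using eq unfolding 1 by (simp add: algebra_simps)
    then have "a i j = a i k" using bs by simp
    then show ?thesis using 1 bs unfolding agree_def by simp
  next
    case 2
    have "a i j * (a j k - a i k) = 0"
      using eq unfolding 2 by (simp add: algebra_simps)
    then have "a j k = a i k" using bs by simp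
    then show ?thesis using 2 bs aki unfolding oppose_def by simp
  qed
qed

text \<open>Along a negative edge \<open>y z\<close> neither \<open>k y\<close> nor
  \<open>k z\<close> is negative. If one of them is positive, the triangle rule makes the two values
  equal; otherwise both vanish.\<close>

lemma neg_component_clan:
  assumes "W \<subseteq> V" "reach neg W i i'" "i \<in> W" "k \<in> W" "\<not> reach neg W i k"
  shows "a i' k = a i k"
  using assms(2)[unfolded reach_def]
proof (induction rule: rtranclp_induct)
  case base
  then show ?case by simp
next
  case (step y z)
  have yz: "y \<in> W" "z \<in> W" "neg y z" using step by auto
  have ry: "reach neg W i y" using step(1) unfolding reach_def .
  have rz: "reach neg W i z" using reach_step[OF ry yz] .
  have nn: "\<not> neg k y" "\<not> neg k z"
    using reach_step[OF ry yz(1) assms(4)] reach_step[OF rz yz(2) assms(4)] assms(5) neg_sym by blast+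
  have "a k y = a k z"
  proof (cases "a k y = 0")
    case False
    then have "pos k y" using pos_neg_cases[of k y] nn yz assms by blast
    then show ?thesis using pos_neg_triangle[of k y z] yz nn assms by blast
  next
    case True
    show ?thesis
    proof (rule ccontr)
      assume "a k y \<noteq> a k z"
      then have "pos k z" using True pos_neg_cases[of k z] nn yz assms by auto
      then have "a k z = a k y" using pos_neg_triangle[of k z y] neg_sym yz nn assms by blast
      then show False using \<open>a k y \<noteq> a k z\<close> by simp
    qed
  qed
  then show ?case using step.IH skewD[OF skew_a, of k y] skewD[OF skew_a, of k z] by simp
qed

text \<open>Every negative component of \<open>V - {v}\<close> contains a negative neighbour of
  \<open>v\<close>, and a positive neighbour of \<open>v\<close> sends its value at \<open>v\<close>
  to all points outside its component. With \<open>C\<close> the component of a positive neighbour,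
  the values between \<open>v\<close>, \<open>C\<close> and the other points are \<open>x\<close> or
  \<open>y\<close> up to sign. Order 4 gives \<open>y = x\<close> or \<open>y = - x\<close>, and
  either sign yields a cut.\<close>

lemma const_cut_of_neg_cut_vertex:
  assumes v: "v \<in> V" and cp: "conn pos V" and cn: "conn neg V" and nc: "\<not> conn neg (V - {v})"
  shows "\<exists>P x. const_cut a V P x"
proof -
  define W where "W = V - {v}"
  let ?R = "reach neg W"
  have WV: "W \<subseteq> V" and VW: "V = insert v W" "v \<notin> W" using v unfolding W_def by auto
  have inV: "i \<in> V" if "i \<in> W" for i using that WV by blast
  have Rsym: "?R j i" if "?R i j" for i j using reach_sym[of neg] neg_sym that by blast
  have cross: "a i k = 0 \<or> pos i k" if "i \<in> W" "k \<in> W" "\<not> ?R i k" for i k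
    using that pos_neg_cases[of i k] reach_edge[of i W k neg] inV by blast
  have clan: "a i' k = a i k" if "?R i i'" "i \<in> W" "k \<in> W" "\<not> ?R i k" for i i' k
    using neg_component_clan[OF WV] that by blast
  have down: "\<exists>u\<in>W. ?R i u \<and> neg v u" if "i \<in> W" for i
  proof -
    have "i \<in> {j \<in> W. ?R i j}" "v \<in> V - {j \<in> W. ?R i j}" "{j \<in> W. ?R i j} \<subseteq> V"
      using that WV VW reach_refl by auto
    then obtain p q where pq: "p \<in> {j \<in> W. ?R i j}" "q \<in> V - {j \<in> W. ?R i j}" "neg p q"
      by (rule connE[OF cn])
    have "q = v"
    proof (rule ccontr)
      assume "q \<noteq> v"
      then have "q \<in> W" using pq VW by blast
      then have "?R i q" using pq reach_edge[of p W q neg] reach_trans[of neg W i p q] by blast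
      then show False using pq \<open>q \<in> W\<close> by blast
    qed
    then show ?thesis using pq neg_sym by blast
  qed
  \<comment> \<open>The triangle formed by \<open>w\<close>, \<open>v\<close> and a negative
    neighbour \<open>u'\<close> of \<open>v\<close> in the component of \<open>u\<close> transfers
    the value to \<open>u'\<close>; the clan property carries it on to \<open>u\<close>.\<close>
  have star: "pos w u \<and> a w u = a w v" if w: "w \<in> W" "pos v w" and u: "u \<in> W" "\<not> ?R w u" for w u
  proof -
    obtain u' where u': "u' \<in> W" "?R u u'" "neg v u'" using down[OF u(1)] by blast
    have nr: "\<not> ?R w u'" using u u' Rsym[of u u'] reach_trans[of neg W w u' u] by blast
    have tri: "(neg w u' \<and> a u' w = a u' v) \<or> (pos w u' \<and> a w v = a w u')"
      using pos_neg_triangle[of w v u'] inV w u' v pos_sym by blast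
    have "\<not> neg w u'" using nr w u' reach_edge[of w W u' neg] by blast
    then have "pos w u'" "a w v = a w u'" using tri by auto
    moreover have "a u' w = a u w" using clan[of u u' w] u u' w Rsym by blast
    moreover have "a w u \<noteq> 0"
      using calculation skewD[OF skew_a, of w u] skewD[OF skew_a, of w u'] unfolding agree_def by simp
    ultimately show ?thesis
      using cross[OF w(1) u] skewD[OF skew_a, of w u] skewD[OF skew_a, of w u'] by simp
  qed
  have "W \<noteq> {}" using nc unfolding W_def conn_def by auto
  then obtain w0 where w0: "w0 \<in> W" "pos v w0"
    using cp v unfolding W_def conn_def by (elim allE[of _ "{v}"]) auto
  define C where "C = {j \<in> W. ?R w0 j}"
  define x where "x = a w0 v"
  have x0: "x \<noteq> 0" using pos_sym[OF w0(2)] unfolding x_def agree_def by simp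
  have w0C: "w0 \<in> C" using w0 reach_refl unfolding C_def by auto
  have CW: "C \<subseteq> W" unfolding C_def by auto
  have Cx: "a i u = x" if "i \<in> C" "u \<in> W - C" for i u
  proof -
    have "\<not> ?R w0 u" "?R w0 i" "u \<in> W" using that unfolding C_def by auto
    then show ?thesis using clan[of w0 i u] star[OF w0, of u] w0 unfolding x_def by simp
  qed
  have Cpos: "pos i u" if "i \<in> C" "u \<in> W - C" for i u
  proof -
    have "\<not> ?R w0 u" "?R w0 i" "u \<in> W" "i \<in> W" using that unfolding C_def by auto
    then have "\<not> ?R i u" using reach_trans[of neg W w0 i u] by blast
    then show ?thesis using cross[of i u] Cx[OF that] x0 that CW by auto
  qed
  obtain u1 where u1: "u1 \<in> C" "neg v u1" using down[OF w0(1)] unfolding C_def by blast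
  obtain t where t: "t \<in> W - C" "neg v t"
  proof -
    obtain r where r: "r \<in> W" "\<not> ?R w0 r"
      using not_conn_imp_not_reach[OF nc neg_sym] unfolding W_def by metis
    obtain t where "t \<in> W" "?R r t" "neg v t" using down[OF r(1)] by blast
    moreover from this have "\<not> ?R w0 t" using r Rsym[of r t] reach_trans[of neg W w0 t r] by blast
    ultimately show ?thesis using that unfolding C_def by blast
  qed
  \<comment> \<open>Each \<open>i\<close> has a positive edge to a negative neighbour of
    \<open>v\<close> across \<open>C\<close>, namely \<open>t\<close> or \<open>u1\<close>; the
    third side of this mixed triangle is nonzero.\<close>
  have nz: "pos v i \<or> neg v i" if "i \<in> W" for i
  proof (rule ccontr)
    assume no: "\<not> ?thesis"
    show False
    proof (cases "i \<in> C")
      case True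
      have "neg i v \<or> pos i v"
        using pos_neg_triangle[of i t v] Cpos[OF True t(1)] neg_sym[OF t(2)] inV[OF that] inV[of t] t v
        by blast
      then show False using no pos_sym neg_sym by blast
    next
      case False
      then have "pos i u1" using Cpos[OF u1(1), of i] that pos_sym by blast
      moreover have "u1 \<in> V" using u1 CW WV by blast
      ultimately have "neg i v \<or> pos i v"
        using pos_neg_triangle[of i u1 v] neg_sym[OF u1(2)] inV[OF that] v by blast
      then show False using no pos_sym neg_sym by blast
    qed
  qed
  have sep: "a v i = a v j" if "i \<in> C" "neg v i" "j \<in> W - C" "neg v j" for i j
  proof -
    have "(neg i v \<and> a v i = a v j) \<or> (pos i v \<and> a i j = a i v)"
      using pos_neg_triangle[of i j v] Cpos[of i j] that neg_sym inV CW v by blast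
    then show ?thesis using that neg_sym pos_not_neg by blast
  qed
  define y where "y = a v t"
  \<comment> \<open>\<open>sep\<close> compares only across \<open>C\<close>, so two points outside
    \<open>C\<close> are compared through \<open>u1\<close>.\<close>
  have Dy: "a v i = y" if "i \<in> W" "neg v i" for i
  proof (cases "i \<in> C")
    case True
    then show ?thesis using sep[of i t] that t unfolding y_def by blast
  next
    case False
    then show ?thesis using sep[of u1 i] sep[of u1 t] that t u1 unfolding y_def by simp
  qed
  have Px: "a w v = x" if "w \<in> C" "pos v w" for w
  proof -
    have "?R w0 w" "w \<in> W" "\<not> ?R w0 t" "t \<in> W" using that t unfolding C_def by auto
    then have "a w t = a w v" using star[of w t] that(2) reach_trans[of neg W w0 w t] by blast
    then show ?thesis using Cx[OF that(1) t(1)] by simp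
  qed
  have Px': "a v w = x" if "w \<in> W - C" "pos v w" for w
  proof -
    have "\<not> ?R w w0" using that Rsym unfolding C_def by blast
    then have "a w w0 = a w v" using star[of w w0] that w0 by blast
    then show ?thesis
      using Cx[OF w0C that(1)] skewD[OF skew_a, of w w0] skewD[OF skew_a, of w v] by simp
  qed
  \<comment> \<open>On a negative path inside \<open>C\<close> from the positive neighbour
    \<open>w0\<close> of \<open>v\<close> to the negative neighbour \<open>u1\<close>, some edge
    \<open>w u\<close> changes type. The sums in \<open>quadruple\<close> for \<open>v\<close>,
    \<open>w\<close>, \<open>u\<close>, \<open>t\<close> then differ by
    \<open>2 * x * y * (x * x - y * y)\<close>.\<close>
  have xy: "y = x \<or> y = - x"
  proof -
    have "?R w0 u1" "u1 \<in> W" using u1 unfolding C_def by auto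
    moreover have "\<not> pos v u1" using u1 pos_not_neg by blast
    ultimately obtain w u where "?R w0 w" "?R w0 u" "w \<in> W" "u \<in> W"
      and "neg w u" "pos v w" "\<not> pos v u"
      using reach_boundary[of neg W w0 u1 "pos v"] w0 by metis
    then have wu: "w \<in> C" "u \<in> C" "neg w u" "pos v w" "\<not> pos v u"
      unfolding C_def by auto
    have mem: "w \<in> W" "u \<in> W" "t \<in> W" using wu CW t by auto
    have vu: "neg v u" using nz[OF mem(2)] wu by blast
    have "(neg v u \<and> a u v = a u w) \<or> (pos v u \<and> a v w = a v u)"
      using pos_neg_triangle[of v w u] wu mem inV v by blast
    then have "a u v = a u w" using wu by blast
    then have a1: "a w u = y"
      using Dy[OF mem(2) vu] skewD[OF skew_a, of u v] skewD[OF skew_a, of u w] by simp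
    have a2: "a v w = - x" using Px[OF wu(1,4)] skewD[OF skew_a, of v w] by simp
    have a3: "a u t = x" "a w t = x" "pos u t" "pos w t" using Cx Cpos wu t by auto
    have a4: "a v t = y" "a v u = y" using Dy vu mem t by auto
    have dist: "distinct [v, w, u, t]"
      using VW mem wu t by (auto simp: oppose_def skew_diag[OF skew_a])
    have b: "b w u = - a w u" "b v w = a v w" "b u t = a u t" "b w t = a w t" "b v t = - a v t" "b v u = - a v u"
      using wu vu a3 t unfolding agree_def oppose_def by auto
    have tw: "a t w = - x" "b t w = - x"
      using a3 b skewD[OF skew_a, of t w] skewD[OF skew_b, of t w] by auto
    \<comment> \<open>On \<open>{v, w, u, t}\<close> both graphs are paths with four vertices.\<close>
    have "x * y * (x * x - y * y) = 0"
      using quadruple[OF v inV[OF mem(1)] inV[OF mem(2)] inV[OF mem(3)] dist] a1 a2 a3 a4 b tw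
      by (simp add: algebra_simps)
    moreover have "y \<noteq> 0" using t unfolding y_def oppose_def by blast
    ultimately have "y * y = x * x" using x0 by simp
    then show ?thesis using square_eq_iff by blast
  qed
  show ?thesis
  proof (cases "y = - x")
    case True
    have "const_cut a V C x"
    proof (rule const_cutI[of w0 _ v])
      fix i j assume i: "i \<in> C" and j: "j \<in> V - C"
      have "a i v = x"
      proof (cases "pos v i")
        case False
        then have "neg v i" "i \<in> W" using nz[of i] i CW by auto
        then show ?thesis using Dy[of i] True skewD[OF skew_a, of v i] by simp
      qed (use Px i in blast)
      then show "a i j = x" using Cx[OF i, of j] j VW by blast
    qed (use w0C v CW VW x0 in auto)
    then show ?thesis by blast
  next
    case False
    then have "y = x" using xy by blast
    then have vx: "a v i = x" if "i \<in> W - C" for i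
      using nz[of i] Px'[of i] Dy[of i] that by auto
    show ?thesis
    proof (cases "\<exists>w\<in>W - C. pos v w")
      case False
      have "const_cut a V (insert v C) x"
      proof (rule const_cutI[of v _ t])
        fix i j assume "i \<in> insert v C" "j \<in> V - insert v C"
        then show "a i j = x" using Cx[of i j] vx[of j] VW by blast
      qed (use t v CW VW x0 in auto)
      then show ?thesis by blast
    next
      case True
      then obtain w where w: "w \<in> W - C" "pos v w" by blast
      define C' where "C' = {j \<in> W. ?R w j}"
      have disj: "C' \<inter> C = {}"
        using w Rsym[of w] reach_trans[of neg W w0 _ w] unfolding C_def C'_def by blast
      have wv: "a w v = - x" using Px'[OF w] skewD[OF skew_a, of w v] by simp
      \<comment> \<open>The component of \<open>w\<close> receives \<open>x\<close> from
        \<open>v\<close> by \<open>vx\<close>, and from all other components by \<open>star\<close>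
        and the clan property.\<close>
      have "const_cut a V (V - C') x"
      proof (rule const_cutI[of v _ w])
        fix i j assume i: "i \<in> V - C'" and j: "j \<in> V - (V - C')"
        have jw: "?R w j" "j \<in> W" "j \<in> W - C" using j disj unfolding C'_def by auto
        show "a i j = x"
        proof (cases "i = v")
          case True
          then show ?thesis using vx jw by blast
        next
          case False
          then have iW: "i \<in> W" "\<not> ?R w i" using i VW unfolding C'_def by auto
          have "a j i = - x"
            using clan[OF jw(1) _ iW] star[OF _ w(2) iW] w(1) wv by auto
          then show ?thesis using skewD[OF skew_a, of i j] by simp
        qed
      qed (use w v VW x0 reach_refl WV in \<open>auto simp: C'_def\<close>)
      then show ?thesis by blast
    qed
  qed
qed

end

text \<open>A connected graph on three points has at least two of the three possible edges, so two
  of them share an edge; on two points there is only one edge.\<close>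

lemma card_ge_4_of_conn:
  fixes V :: "'v set"
  assumes "conn E V" "conn F V" "finite V" "card V \<ge> 2"
    and "\<And>i j. E i j \<Longrightarrow> E j i" "\<And>i j. F i j \<Longrightarrow> F j i" "\<And>i j. E i j \<Longrightarrow> \<not> F i j"
  shows "card V \<ge> 4"
proof (rule ccontr)
  assume "\<not> ?thesis"
  then consider "card V = 2" | "card V = 3" using assms(4) by linarith
  then show False
  proof cases
    case 1
    then obtain i j where V: "V = {i, j}" "i \<noteq> j" by (auto simp: card_2_iff)
    then have "E i j" "F i j"
      using connE[OF assms(1), of i "{i}" j] connE[OF assms(2), of i "{i}" j] by blast+
    then show False using assms(7) by blast
  next
    case 2
    then obtain i j k where V: "V = {i, j, k}" "i \<noteq> j" "j \<noteq> k" "i \<noteq> k" by (auto simp: card_3_iff)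
    have "G i j \<or> G i k" "G j i \<or> G j k" "G k i \<or> G k j" if G: "conn G V" for G
      using V connE[OF G, of i "{i}" j] connE[OF G, of j "{j}" i] connE[OF G, of k "{k}" i] by blast+
    from this[OF assms(1)] this[OF assms(2)] show False using assms(5-7) by metis
  qed
qed

lemma const_cut_of_conn:
  assumes "same_minors V a b" "finite V" "card V \<ge> 2"
    and "conn (agree a b) V" "conn (oppose a b) V"
  shows "\<exists>P x. const_cut a V P x"
  using assms
proof (induction "card V" arbitrary: V rule: less_induct)
  case less
  interpret same_minors V a b by fact
  have c4: "card W \<ge> 4" if "W \<subseteq> V" "conn pos W" "conn neg W" "card W \<ge> 2" for W
    using that less.prems(2) finite_subset pos_sym neg_sym pos_not_neg
    by (intro card_ge_4_of_conn[of pos W neg]) auto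
  show ?case
  proof (cases "\<exists>v\<in>V. \<not> (conn pos (V - {v}) \<and> conn neg (V - {v}))")
    case True
    then obtain v where v: "v \<in> V" "\<not> conn neg (V - {v}) \<or> \<not> conn pos (V - {v})" by blast
    \<comment> \<open>A cut vertex of the positive graph becomes one of the negative graph when
      \<open>b\<close> is negated.\<close>
    then show ?thesis
      using const_cut_of_neg_cut_vertex less.prems(4,5)
        same_minors.const_cut_of_neg_cut_vertex[OF same_minors_uminus[OF less.prems(1)], of v]
      unfolding agree_uminus oppose_uminus by blast
  next
    case False
    have cV: "card V \<ge> 4" using c4[of V] less.prems by blast
    have cv: "card (V - {v}) = card V - 1" if "v \<in> V" for v using that less.prems(2) by simp
    have "V \<noteq> {}" using cV by auto
    then obtain v where v: "v \<in> V" by blast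
    \<comment> \<open>Both graphs remain connected after the deletion, so the bound of four points
      applies to \<open>V - {v}\<close> and leaves five in \<open>V\<close>.\<close>
    have "card (V - {v}) \<ge> 4" using c4[of "V - {v}"] False v cv[OF v] cV by fastforce
    then have "card V \<ge> 5" using cv[OF v] by linarith
    moreover have "\<exists>P x. const_cut a (V - {v}) P x" if "v \<in> V" for v
    proof (rule less.hyps)
      show "same_minors (V - {v}) a b" using same_minors_subset less.prems(1) by blast
      show "card (V - {v}) < card V" using that less.prems(2) by (intro card_Diff1_less)
    qed (use cv[OF that] cV False that less.prems in auto)
    ultimately show ?thesis using const_cut_critical[OF skew_a less.prems(2)] by blast
  qed
qed

section \<open>Principal minors of generalized tournament matrices\<close>

text \<open>Expansion along the first column with the cofactors again of the form
  \<open>mat n n\<close>, so that rewriting evaluates determinants of small fixed order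
  recursively.\<close>

lemma det_mat_Suc:
  fixes f :: "nat \<times> nat \<Rightarrow> 'a :: comm_ring_1"
  shows "det (mat (Suc n) (Suc n) f) = (\<Sum>i<Suc n. (- 1) ^ i * f (i, 0) *
    det (mat n n (\<lambda>(r, s). f (if r < i then r else Suc r, Suc s))))"
proof -
  have "mat_delete (mat (Suc n) (Suc n) f) i 0 =
      mat n n (\<lambda>(r, s). f (if r < i then r else Suc r, Suc s))" if "i < Suc n" for i
    using that by (intro eq_matI) (auto simp: mat_delete_def)
  then show ?thesis
    by (subst laplace_expansion_column[of _ "Suc n" 0])
      (auto simp: cofactor_def ac_simps intro!: sum.cong)
qed

lemma det_mat_0: "det (mat 0 0 f) = 1"
  by (rule det_dim_zero) simp

section \<open>Explicit principal minors of orders 2 to 4\<close>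

lemma pick_doubleton:
  fixes i j :: nat
  assumes "i < j"
  shows "pick {i, j} 0 = i" "pick {i, j} (Suc 0) = j"
proof -
  show 0: "pick {i, j} 0 = i" using assms by (auto intro!: Least_equality)
  show "pick {i, j} (Suc 0) = j" unfolding pick.simps(2) 0 using assms by (auto intro!: Least_equality)
qed

lemma pick_tripleton:
  fixes i j k :: nat
  assumes "i < j" "j < k"
  shows "pick {i, j, k} 0 = i" "pick {i, j, k} (Suc 0) = j" "pick {i, j, k} (Suc (Suc 0)) = k"
proof -
  show 0: "pick {i, j, k} 0 = i" using assms by (auto intro!: Least_equality)
  show 1: "pick {i, j, k} (Suc 0) = j"
    unfolding pick.simps(2) 0 using assms by (auto intro!: Least_equality)
  show "pick {i, j, k} (Suc (Suc 0)) = k"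
    unfolding pick.simps(2)[of _ "Suc 0"] 1 using assms by (auto intro!: Least_equality)
qed

lemma pick_quadrupleton:
  fixes i j k l :: nat
  assumes "i < j" "j < k" "k < l"
  shows "pick {i, j, k, l} 0 = i" "pick {i, j, k, l} (Suc 0) = j"
    "pick {i, j, k, l} (Suc (Suc 0)) = k" "pick {i, j, k, l} (Suc (Suc (Suc 0))) = l"
proof -
  show 0: "pick {i, j, k, l} 0 = i" using assms by (auto intro!: Least_equality)
  show 1: "pick {i, j, k, l} (Suc 0) = j"
    unfolding pick.simps(2) 0 using assms by (auto intro!: Least_equality)
  show 2: "pick {i, j, k, l} (Suc (Suc 0)) = k"
    unfolding pick.simps(2)[of _ "Suc 0"] 1 using assms by (auto intro!: Least_equality)
  show "pick {i, j, k, l} (Suc (Suc (Suc 0))) = l"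
    unfolding pick.simps(2)[of _ "Suc (Suc 0)"] 2 using assms by (auto intro!: Least_equality)
qed

lemma principal_minor_eq:
  assumes "M \<in> carrier_mat n n" "X \<subseteq> {0..<n}"
  shows "principal_minor M X = det (mat (card X) (card X) (\<lambda>(i, j). M $$ (pick X i, pick X j)))"
proof -
  have "{i. i < dim_row M \<and> i \<in> X} = X" "{i. i < dim_col M \<and> i \<in> X} = X" using assms by auto
  then show ?thesis unfolding principal_minor_def submatrix_def by simp
qed

text \<open>Twice the usual skew-symmetric part, so that the matrix is half of
  \<open>J - I + S\<close>.\<close>

definition skew_part :: "real mat \<Rightarrow> nat \<Rightarrow> nat \<Rightarrow> real" where
  "skew_part M i j = M $$ (i, j) - M $$ (j, i)"

lemma skew_skew_part: "skew (skew_part M)"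
  unfolding skew_def skew_part_def by simp

lemma gen_tournament_entries:
  assumes "gen_tournament n M" "i < n" "j < n"
  shows "M $$ (i, j) = (if i = j then 0 else (1 + skew_part M i j) / 2)"
proof -
  have M: "M \<in> carrier_mat n n" "M + transpose_mat M = all_ones_mat n - 1\<^sub>m n"
    using assms unfolding gen_tournament_def by auto
  have "M $$ (i, j) + M $$ (j, i) = (M + transpose_mat M) $$ (i, j)" using M(1) assms by auto
  also have "\<dots> = (if i = j then 0 else 1)" unfolding M(2) all_ones_mat_def using assms by simp
  finally show ?thesis unfolding skew_part_def by (auto split: if_splits simp: field_simps)
qed

lemma principal_minor_2:
  assumes gt: "gen_tournament n M" and "i < j" "j < n"
  defines "s \<equiv> skew_part M"
  shows "4 * principal_minor M {i, j} = (s i j)\<^sup>2 - 1"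
proof -
  have M: "M \<in> carrier_mat n n" using gt unfolding gen_tournament_def by blast
  have c: "card {i, j} = Suc (Suc 0)" using assms by auto
  have ent: "M $$ (p, q) = (if p = q then 0 else (1 + s p q) / 2)" if "p \<in> {i, j}" "q \<in> {i, j}" for p q
    unfolding s_def using assms that by (intro gen_tournament_entries[OF gt]) auto
  have sk: "s j i = - s i j" unfolding s_def by (rule skewD[OF skew_skew_part])
  show ?thesis
    using assms(2,3)
    by (subst principal_minor_eq[OF M], force, unfold c)
      (simp add: det_mat_Suc det_mat_0 pick_doubleton del: pick.simps, simp add: ent sk field_simps power2_eq_square)
qed

lemma principal_minor_3:
  assumes gt: "gen_tournament n M" and "i < j" "j < k" "k < n"
  defines "s \<equiv> skew_part M"
  shows "4 * principal_minor M {i, j, k} = 1 + (s i j * s j k + s j k * s k i + s k i * s i j)"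
proof -
  have M: "M \<in> carrier_mat n n" using gt unfolding gen_tournament_def by blast
  have c: "card {i, j, k} = Suc (Suc (Suc 0))" using assms by auto
  have ent: "M $$ (p, q) = (if p = q then 0 else (1 + s p q) / 2)"
    if "p \<in> {i, j, k}" "q \<in> {i, j, k}" for p q
    unfolding s_def using assms that by (intro gen_tournament_entries[OF gt]) auto
  have sk: "s j i = - s i j" "s k i = - s i k" "s k j = - s j k"
    unfolding s_def by (rule skewD[OF skew_skew_part])+
  show ?thesis
    using assms(2-4)
    by (subst principal_minor_eq[OF M], force, unfold c)
      (simp add: det_mat_Suc det_mat_0 pick_tripleton del: pick.simps, simp add: ent sk field_simps)
qed

text \<open>With a zero diagonal only the three double transpositions and the six 4-cycles
  contribute, and opposite 4-cycles cancel each other's terms of odd degree. Orders 2 and 3 fix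
  every summand but the last.\<close>

lemma principal_minor_4:
  assumes gt: "gen_tournament n M" and "i < j" "j < k" "k < l" "l < n"
  defines "s \<equiv> skew_part M"
  defines "p \<equiv> s i j * s k l" and "q \<equiv> s i k * s l j" and "r \<equiv> s i l * s j k"
  defines "T \<equiv> \<lambda>i j k. s i j * s j k + s j k * s k i + s k i * s i j"
  shows "16 * principal_minor M {i, j, k, l} =
    (1 - (s i j)\<^sup>2) * (1 - (s k l)\<^sup>2) + (1 - (s i k)\<^sup>2) * (1 - (s j l)\<^sup>2) + (1 - (s i l)\<^sup>2) * (1 - (s j k)\<^sup>2)
    - 6 - 2 * (T i j k + T i j l + T i k l + T j k l) + 2 * (p * q + q * r + r * p)"
proof -
  have M: "M \<in> carrier_mat n n" using gt unfolding gen_tournament_def by blast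
  have c: "card {i, j, k, l} = Suc (Suc (Suc (Suc 0)))" using assms by auto
  have ent: "M $$ (p, q) = (if p = q then 0 else (1 + s p q) / 2)"
    if "p \<in> {i, j, k, l}" "q \<in> {i, j, k, l}" for p q
    unfolding s_def using assms that by (intro gen_tournament_entries[OF gt]) auto
  have sk: "s j i = - s i j" "s k i = - s i k" "s k j = - s j k" "s l i = - s i l" "s l j = - s j l" "s l k = - s k l"
    unfolding s_def by (rule skewD[OF skew_skew_part])+
  show ?thesis
    using assms(2-5) unfolding p_def q_def r_def T_def
    by (subst principal_minor_eq[OF M], force, unfold c)
      (simp add: det_mat_Suc det_mat_0 pick_quadrupleton del: pick.simps,
       simp add: ent sk field_simps power2_eq_square)
qed

text \<open>Adjacent swaps generate all orders; the minors are computed for increasing indices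
  only.\<close>

lemma distinct_triple_wlog:
  fixes P :: "nat \<Rightarrow> nat \<Rightarrow> nat \<Rightarrow> bool"
  assumes swap1: "\<And>i j k. P i j k \<Longrightarrow> P j i k" and swap2: "\<And>i j k. P i j k \<Longrightarrow> P i k j"
    and sorted: "\<And>i j k. i < j \<Longrightarrow> j < k \<Longrightarrow> P i j k"
    and "distinct [i, j, k]"
  shows "P i j k"
proof -
  consider "i < j" "j < k" | "i < k" "k < j" | "j < i" "i < k" | "j < k" "k < i"
    | "k < i" "i < j" | "k < j" "j < i"
    using nat_neq_iff[of i j] nat_neq_iff[of i k] nat_neq_iff[of j k] assms(4) by simp blast
  then show ?thesis
  proof cases
    case 1
    then show ?thesis by (rule sorted)
  next
    case 2
    then show ?thesis by (rule swap2[OF sorted])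
  next
    case 3
    then show ?thesis by (rule swap1[OF sorted])
  next
    case 4
    then show ?thesis by (rule swap1[OF swap2[OF sorted]])
  next
    case 5
    then show ?thesis by (rule swap2[OF swap1[OF sorted]])
  next
    case 6
    then show ?thesis by (rule swap1[OF swap2[OF swap1[OF sorted]]])
  qed
qed

lemma distinct_quadruple_wlog:
  fixes P :: "nat \<Rightarrow> nat \<Rightarrow> nat \<Rightarrow> nat \<Rightarrow> bool"
  assumes swap1: "\<And>i j k l. P i j k l \<Longrightarrow> P j i k l" and swap2: "\<And>i j k l. P i j k l \<Longrightarrow> P i k j l"
    and swap3: "\<And>i j k l. P i j k l \<Longrightarrow> P i j l k"
    and sorted: "\<And>i j k l. i < j \<Longrightarrow> j < k \<Longrightarrow> k < l \<Longrightarrow> P i j k l"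
    and dist: "distinct [i, j, k, l]"
  shows "P i j k l"
proof -
  \<comment> \<open>The first three indices are sorted with \<open>l\<close> kept fixed, then
    \<open>l\<close> is moved into place by adjacent swaps.\<close>
  have "l \<noteq> i \<and> l \<noteq> j \<and> l \<noteq> k \<longrightarrow> P i j k l"
  proof (rule distinct_triple_wlog[where P = "\<lambda>i j k. l \<noteq> i \<and> l \<noteq> j \<and> l \<noteq> k \<longrightarrow> P i j k l"])
    show "l \<noteq> j \<and> l \<noteq> i \<and> l \<noteq> k \<longrightarrow> P j i k l"
      if "l \<noteq> i \<and> l \<noteq> j \<and> l \<noteq> k \<longrightarrow> P i j k l" for i j k
      using that swap1[of i j k l] by blast
    show "l \<noteq> i \<and> l \<noteq> k \<and> l \<noteq> j \<longrightarrow> P i k j l"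
      if "l \<noteq> i \<and> l \<noteq> j \<and> l \<noteq> k \<longrightarrow> P i j k l" for i j k
      using that swap2[of i j k l] by blast
    fix i j k :: nat assume ij: "i < j" "j < k"
    show "l \<noteq> i \<and> l \<noteq> j \<and> l \<noteq> k \<longrightarrow> P i j k l"
    proof
      assume "l \<noteq> i \<and> l \<noteq> j \<and> l \<noteq> k"
      then consider "k < l" | "j < l" "l < k" | "i < l" "l < j" | "l < i" by linarith
      then show "P i j k l"
      proof cases
        case 1
        then show ?thesis using sorted ij by blast
      next
        case 2
        then show ?thesis using swap3[OF sorted[of i j l k]] ij by blast
      next
        case 3
        then show ?thesis using swap3[OF swap2[OF sorted[of i l j k]]] ij by blast
      next
        case 4
        then show ?thesis using swap3[OF swap2[OF swap1[OF sorted[of l i j k]]]] ij by blast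
      qed
    qed
  qed (use dist in simp)
  then show ?thesis using dist by auto
qed

lemma same_minors_skew_part:
  assumes A: "gen_tournament n A" and B: "gen_tournament n B"
    and minors: "\<And>X. X \<subseteq> {0..<n} \<Longrightarrow> card X \<le> 4 \<Longrightarrow> principal_minor A X = principal_minor B X"
  shows "same_minors {0..<n} (skew_part A) (skew_part B)"
proof -
  define a where "a = skew_part A"
  define b where "b = skew_part B"
  define T where "T s i j k = s i j * s j k + s j k * s k i + s k i * s i j"
    for s :: "nat \<Rightarrow> nat \<Rightarrow> real" and i j k
  define F where "F s i j k l = (s i j * s k l) * (s i k * s l j) + (s i k * s l j) * (s i l * s j k)
      + (s i l * s j k) * (s i j * s k l)"
    for s :: "nat \<Rightarrow> nat \<Rightarrow> real" and i j k l
  have sk: "skew a" "skew b" unfolding a_def b_def by (rule skew_skew_part)+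
  have card4: "card {i, j, k, l} \<le> 4" for i j k l :: nat
    by (simp add: card_insert_if)
  have eq: "principal_minor A X = principal_minor B X" if "X \<subseteq> {0..<n}" "\<exists>i j k l. X = {i, j, k, l}" for X
    using minors[OF that(1)] that(2) card4 by blast
  have sq_less: "(a i j)\<^sup>2 = (b i j)\<^sup>2" if "i < j" "j < n" for i j
    using principal_minor_2[OF A that] principal_minor_2[OF B that] eq[of "{i, j}"] that
    unfolding a_def b_def by fastforce
  have sq: "(a i j)\<^sup>2 = (b i j)\<^sup>2" if "i < n" "j < n" for i j
  proof (cases i j rule: linorder_cases)
    case greater
    then show ?thesis using sq_less[of j i] that skewD[OF sk(1), of i j] skewD[OF sk(2), of i j] by simp
  qed (use sq_less that skew_diag[OF sk(1)] skew_diag[OF sk(2)] in auto)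
  have Tswap: "T s j i k = T s i j k" "T s i k j = T s i j k" if "skew s" for s i j k
    using skewD[OF that, of j i] skewD[OF that, of k i] skewD[OF that, of k j]
    unfolding T_def by (simp_all add: algebra_simps)
  have T_less: "T a i j k = T b i j k" if "i < j" "j < k" "k < n" for i j k
    using principal_minor_3[OF A that] principal_minor_3[OF B that] eq[of "{i, j, k}"] that
    unfolding a_def b_def T_def by fastforce
  have T_dist: "i < n \<and> j < n \<and> k < n \<longrightarrow> T a i j k = T b i j k" if "distinct [i, j, k]" for i j k
    by (rule distinct_triple_wlog[OF _ _ _ that])
      (simp_all add: Tswap[OF sk(1)] Tswap[OF sk(2)] T_less)
  have T_all: "T a i j k = T b i j k" if ijk: "i < n" "j < n" "k < n" for i j k
  proof (cases "distinct [i, j, k]")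
    case False
    \<comment> \<open>With a repeated index \<open>T\<close> degenerates to minus a square, so order
      2 suffices.\<close>
    have *: "T s i i k = - (s i k)\<^sup>2" if "skew s" for s i k
      using skewD[OF that, of i k] skew_diag[OF that] unfolding T_def by (simp add: power2_eq_square)
    have **: "T s i k i = - (s i k)\<^sup>2" "T s k i i = - (s i k)\<^sup>2" if "skew s" for s i k
      using *[OF that, of i k] Tswap(2)[OF that, of i i k] Tswap(1)[OF that, of k i i] by simp_all
    consider "i = j" | "i = k" | "j = k" using False by auto
    then show ?thesis
    proof cases
      case 1
      then show ?thesis using *[OF sk(1)] *[OF sk(2)] sq ijk by simp
    next
      case 2
      then show ?thesis using **[OF sk(1)] **[OF sk(2)] sq ijk by simp
    next
      case 3
      then show ?thesis using **[OF sk(1)] **[OF sk(2)] sq ijk by simp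
    qed
  qed (use T_dist that in blast)
  \<comment> \<open>Each adjacent swap permutes the three products \<open>s i j * s k l\<close>,
    \<open>s i k * s l j\<close>, \<open>s i l * s j k\<close> and negates all of them.\<close>
  have Fswap: "F s j i k l = F s i j k l" "F s i k j l = F s i j k l" "F s i j l k = F s i j k l"
    if "skew s" for s i j k l
    using skewD[OF that, of j i] skewD[OF that, of k i] skewD[OF that, of k j]
      skewD[OF that, of l i] skewD[OF that, of l j] skewD[OF that, of l k]
    unfolding F_def by (simp_all add: algebra_simps)
  have F_less: "F a i j k l = F b i j k l" if "i < j" "j < k" "k < l" "l < n" for i j k l
  proof -
    have pm: "16 * principal_minor M {i, j, k, l} =
      (1 - (s i j)\<^sup>2) * (1 - (s k l)\<^sup>2) + (1 - (s i k)\<^sup>2) * (1 - (s j l)\<^sup>2) + (1 - (s i l)\<^sup>2) * (1 - (s j k)\<^sup>2)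
      - 6 - 2 * (T s i j k + T s i j l + T s i k l + T s j k l) + 2 * F s i j k l"
      if "gen_tournament n M" "s = skew_part M" for M s
      using principal_minor_4[OF that(1) \<open>i < j\<close> \<open>j < k\<close> \<open>k < l\<close> \<open>l < n\<close>]
      unfolding that(2) T_def F_def .
    have "principal_minor A {i, j, k, l} = principal_minor B {i, j, k, l}"
      using that by (intro eq) auto
    moreover have "i < n" "j < n" "k < n" using that by auto
    ultimately show ?thesis
      using pm[OF A a_def] pm[OF B b_def] that by (simp add: T_all sq)
  qed
  have F_dist: "i < n \<and> j < n \<and> k < n \<and> l < n \<longrightarrow> F a i j k l = F b i j k l"
    if "distinct [i, j, k, l]" for i j k l
    by (rule distinct_quadruple_wlog[OF _ _ _ _ that])
      (simp_all add: Fswap[OF sk(1)] Fswap[OF sk(2)] F_less)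
  show ?thesis
    unfolding a_def[symmetric] b_def[symmetric]
  proof
    show "skew a" "skew b" by (rule sk)+
    show "b i j = a i j \<or> b i j = - a i j" if "i \<in> {0..<n}" "j \<in> {0..<n}" for i j
      using sq[of i j, symmetric] that by (simp add: power2_eq_iff)
    show "a i j * a j k + a j k * a k i + a k i * a i j = b i j * b j k + b j k * b k i + b k i * b i j"
      if "i \<in> {0..<n}" "j \<in> {0..<n}" "k \<in> {0..<n}" for i j k
      using T_all[of i j k] that unfolding T_def by simp
    show "(a i j * a k l) * (a i k * a l j) + (a i k * a l j) * (a i l * a j k) + (a i l * a j k) * (a i j * a k l) =
      (b i j * b k l) * (b i k * b l j) + (b i k * b l j) * (b i l * b j k) + (b i l * b j k) * (b i j * b k l)"
      if "i \<in> {0..<n}" "j \<in> {0..<n}" "k \<in> {0..<n}" "l \<in> {0..<n}" "distinct [i, j, k, l]" for i j k l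
      using F_dist[OF that(5)] that(1-4) unfolding F_def by simp
  qed
qed

section \<open>Consequences of indecomposability for cuts and components\<close>

lemma clan_of_skew_part:
  assumes "gen_tournament n A" "X \<subseteq> {0..<n}"
    and "\<And>i j k. i \<in> X \<Longrightarrow> j \<in> X \<Longrightarrow> k \<in> {0..<n} - X \<Longrightarrow> skew_part A i k = skew_part A j k"
  shows "is_clan n A X"
  unfolding is_clan_def
proof (intro conjI ballI)
  fix i j k assume ijk: "i \<in> X" "j \<in> X" "k \<in> {0..<n} - X"
  then have lt: "i < n" "j < n" "k < n" "i \<noteq> k" "j \<noteq> k" using assms(2) by auto
  have eq: "skew_part A i k = skew_part A j k" using assms(3) ijk by blast
  then show "A $$ (i, k) = A $$ (j, k)" using lt by (simp add: gen_tournament_entries[OF assms(1)])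
  have "skew_part A k i = skew_part A k j"
    using eq skewD[OF skew_skew_part, of A i k] skewD[OF skew_skew_part, of A j k] by simp
  then show "A $$ (k, i) = A $$ (k, j)" using lt by (simp add: gen_tournament_entries[OF assms(1)])
qed (use assms(2) in auto)

text \<open>Constancy across the cut makes both sides clans, hence singletons, which would mean
  \<open>n = 2\<close>.\<close>

lemma indecomposable_not_const_cut:
  assumes "gen_tournament n A" "indecomposable n A" "n \<ge> 3"
  shows "\<not> const_cut (skew_part A) {0..<n} P x"
proof
  assume J: "const_cut (skew_part A) {0..<n} P x"
  have triv: "card P = 1" if J: "const_cut (skew_part A) {0..<n} P x" for P x
  proof -
    have "is_clan n A P"
      using J const_cutD[OF J] by (intro clan_of_skew_part[OF assms(1)]) (auto simp: const_cut_def)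
    then show ?thesis using assms(2) J unfolding indecomposable_def const_cut_def by blast
  qed
  have "P \<subseteq> {0..<n}" using J unfolding const_cut_def by blast
  then have "card ({0..<n} - P) = n - card P" by (simp add: card_Diff_subset finite_subset)
  then show False using triv[OF J] triv[OF const_cut_compl[OF skew_skew_part J]] assms(3) by simp
qed

text \<open>The given edge puts two distinct points into one component, so this clan can only be the
  whole set.\<close>

lemma indecomposable_conn:
  assumes gt: "gen_tournament n A" and "indecomposable n A"
    and "same_minors {0..<n} (skew_part A) b"
    and ij: "i < n" "j < n" "oppose (skew_part A) b i j"
  shows "conn (oppose (skew_part A) b) {0..<n}"
proof (rule ccontr)
  interpret same_minors "{0..<n}" "skew_part A" b by fact
  assume "\<not> ?thesis"
  then obtain u where u: "u \<in> {0..<n}" "\<not> reach neg {0..<n} i u"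
    by (rule not_conn_imp_not_reach[OF _ neg_sym, where i = i])
  define C where "C = {k \<in> {0..<n}. reach neg {0..<n} i k}"
  have "is_clan n A C"
  proof (rule clan_of_skew_part[OF gt])
    fix p q k assume *: "p \<in> C" "q \<in> C" "k \<in> {0..<n} - C"
    then show "skew_part A p k = skew_part A q k"
      using neg_component_clan[of "{0..<n}" i _ k] ij unfolding C_def by auto
  qed (auto simp: C_def)
  moreover have "C \<noteq> {0..<n}" using u unfolding C_def by blast
  moreover have "i \<in> C" "j \<in> C"
    using ij reach_refl[of neg _ i] reach_edge[of i "{0..<n}" j neg] unfolding C_def by auto
  moreover have "i \<noteq> j" using ij skew_diag[OF skew_a] unfolding oppose_def by blast
  ultimately show False
    using assms(2) unfolding indecomposable_def by (metis card_1_singletonE empty_iff singletonD)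
qed

theorem theorem4p1:
  fixes n :: nat and A B :: "real mat"
  assumes "n \<ge> 4"
    and "gen_tournament n A" and "gen_tournament n B"
    and "indecomposable n A"
    and "\<forall>X. X \<subseteq> {0..<n} \<and> card X \<le> 4 \<longrightarrow> principal_minor A X = principal_minor B X"
  shows "A = B \<or> A = transpose_mat B"
proof -
  let ?a = "skew_part A" and ?b = "skew_part B" and ?V = "{0..<n}"
  have m: "same_minors ?V ?a ?b"
    using assms(2,3,5) by (intro same_minors_skew_part) auto
  interpret same_minors ?V ?a ?b by (rule m)
  have AB: "A \<in> carrier_mat n n" "B \<in> carrier_mat n n"
    using assms(2,3) unfolding gen_tournament_def by auto
  note entA = gen_tournament_entries[OF assms(2)] and entB = gen_tournament_entries[OF assms(3)]
  consider "\<And>i j. i < n \<Longrightarrow> j < n \<Longrightarrow> \<not> neg i j" | "\<And>i j. i < n \<Longrightarrow> j < n \<Longrightarrow> \<not> pos i j"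
    | i j k l where "i < n" "j < n" "neg i j" "k < n" "l < n" "pos k l"
    by blast
  then show ?thesis
  proof cases
    case 1
    have "?b i j = ?a i j" if "i < n" "j < n" for i j
      using 1[OF that] sign_cases[of i j] that unfolding oppose_def by auto
    then have "A = B" using AB by (intro eq_matI) (auto simp: entA entB)
    then show ?thesis ..
  next
    case 2
    have "?b j i = ?a i j" if "i < n" "j < n" for i j
      using 2[OF that] sign_cases[of i j] that skewD[OF skew_b, of i j] unfolding agree_def by auto
    then have "A = transpose_mat B" using AB by (intro eq_matI) (auto simp: entA entB)
    then show ?thesis ..
  next
    case 3
    have "conn neg ?V" using indecomposable_conn[OF assms(2,4) m 3(1-3)] .
    \<comment> \<open>For the pair \<open>?a\<close> and the negative of \<open>?b\<close>, the
      positive edge \<open>k l\<close> is a negative one.\<close>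
    moreover have "conn pos ?V"
      using indecomposable_conn[OF assms(2,4) same_minors_uminus[OF m] 3(4,5)] 3(6)
      unfolding oppose_uminus .
    ultimately obtain P x where "const_cut ?a ?V P x"
      using const_cut_of_conn[OF m] assms(1) by auto
    then show ?thesis using indecomposable_not_const_cut[OF assms(2,4)] assms(1) by fastforce
  qed
qed

end
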